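(* Let $\theta = p/q \in (0,1]$, where $p$ and $q$ are positive integers such that $p$ divides $q+1$, and let $(a_i)_{i=1}^{\infty}$ be the infinite greedy underapproximation sequence of $\theta$. Then \[ a_1 = \frac{q+1}{p} \] and, for all $k \geq 1$, \[ a_{k+1} = q\prod_{i=1}^k a_i + 1 \qquad\text{and}\qquad \frac{p}{q} = \sum_{i=1}^k \frac{1}{a_i} + \frac{1}{q\prod_{i=1}^k a_i}. \]
   Context: For $\theta \in (0,1]$ let $G(\theta) = \lfloor 1/\theta \rfloor + 1$; equivalently $G(\theta)$ is the unique integer $a \geq 2$ with $1/a < \theta \leq 1/(a-1)$. The infinite greedy underapproximation sequence $(a_i)_{i=1}^\infty$ of $\theta\in(0,1]$ is defined by $a_1 = G(\theta)$ and $a_{i+1} = G\left(\theta - \sum_{j=1}^i \frac{1}{a_j}\right)$ for all $i \geq 1$. *)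

theory Defs
  imports Complex_Main
begin

definition G :: "real \<Rightarrow> int" where
  "G \<theta> = \<lfloor>1 / \<theta>\<rfloor> + 1"

lemma G_unique:
  assumes "0 < \<theta>" "\<theta> \<le> 1"
  shows "a = G \<theta> \<longleftrightarrow> a \<ge> 2 \<and> 1 / real_of_int a < \<theta> \<and> \<theta> \<le> 1 / real_of_int (a - 1)"
proof -
  have *: "1 / \<theta> \<ge> 1" using assms by simp
  have "a = G \<theta> \<longleftrightarrow> \<lfloor>1 / \<theta>\<rfloor> = a - 1" by (auto simp: G_def)
  also have "\<dots> \<longleftrightarrow> real_of_int (a - 1) \<le> 1 / \<theta> \<and> 1 / \<theta> < real_of_int a"
    by (simp add: floor_eq_iff)
  also have "\<dots> \<longleftrightarrow> a \<ge> 2 \<and> real_of_int (a - 1) \<le> 1 / \<theta> \<and> 1 / \<theta> < real_of_int a"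
    using * by auto
  also have "\<dots> \<longleftrightarrow> a \<ge> 2 \<and> 1 / real_of_int a < \<theta> \<and> \<theta> \<le> 1 / real_of_int (a - 1)"
    using assms by (auto simp: field_simps)
  finally show ?thesis .
qed

(* Sequences are indexed from 1; the value at index 0 is irrelevant. *)
fun greedy_underapprox :: "real \<Rightarrow> nat \<Rightarrow> int" where
  "greedy_underapprox \<theta> n = G (\<theta> - (\<Sum>j = 1..<n. 1 / real_of_int (greedy_underapprox \<theta> j)))"

declare greedy_underapprox.simps [simp del]

lemma greedy_underapprox_1: "greedy_underapprox \<theta> 1 = G \<theta>"
  by (subst greedy_underapprox.simps) simp

lemma greedy_underapprox_step:
  "greedy_underapprox \<theta> (i + 1) = G (\<theta> - (\<Sum>j = 1..i. 1 / real_of_int (greedy_underapprox \<theta> j)))"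
  by (subst greedy_underapprox.simps) (simp add: atLeastLessThanSuc_atLeastAtMost)

end

(* The remainder after one step is p/q - p/(q+1) = 1/(q * a 1), a unit fraction. From then on the
   greedy choice for a remainder 1/N is N + 1, and it leaves 1/N - 1/(N+1) = 1/(N * (N+1)). *)
theory Submission
  imports Defs
begin

text \<open>Divisibility enters at the first step: with q + 1 = p * m, \<open>G_fraction_dvd\<close>
  gives a 1 = m, and the remainder is 1/(q * m). Thereafter the remainder stays a unit fraction 1/N
  with N = q * a 1 * ... * a k: \<open>G_inverse_of_int\<close> gives the next term N + 1, and
  subtracting its reciprocal multiplies N by exactly that term. This one invariant yields both the
  recurrence and the sum formula.\<close>

lemma G_inverse_of_int: "G (1 / real_of_int N) = N + 1"
  by (simp add: G_def)

text \<open>The reciprocal q/p equals m - 1/p with 0 < 1/p \<le> 1, so its floor is m - 1, also when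
  p = 1.\<close>

lemma G_fraction_dvd:
  fixes p q m :: int
  assumes "p > 0" and "q + 1 = p * m"
  shows "G (real_of_int p / real_of_int q) = m"
proof -
  have q: "real_of_int q = real_of_int p * real_of_int m - 1"
    using arg_cong[OF assms(2), of real_of_int] by simp
  have "1 / (real_of_int p / real_of_int q) = real_of_int m - 1 / real_of_int p"
    using assms(1) by (simp add: q field_simps)
  moreover have "\<lfloor>real_of_int m - 1 / real_of_int p\<rfloor> = m - 1"
    using assms(1) by (simp add: floor_eq_iff)
  ultimately show ?thesis by (simp add: G_def)
qed

theorem theorem1p1:
  fixes \<theta> :: real and p q :: int and a :: "nat \<Rightarrow> int"
  assumes "p > 0" and "q > 0"
    and "\<theta> = real_of_int p / real_of_int q"
    and "0 < \<theta>" and "\<theta> \<le> 1"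
    and "p dvd q + 1"
    and "a = greedy_underapprox \<theta>"
  shows "real_of_int (a 1) = (real_of_int q + 1) / real_of_int p \<and>
    (\<forall>k\<ge>1.
       a (k + 1) = q * (\<Prod>i = 1..k. a i) + 1 \<and>
       real_of_int p / real_of_int q =
         (\<Sum>i = 1..k. 1 / real_of_int (a i)) + 1 / (real_of_int q * (\<Prod>i = 1..k. real_of_int (a i))))"
proof -
  obtain m where m: "q + 1 = p * m" using \<open>p dvd q + 1\<close> by (rule dvdE)
  have a1: "a 1 = m"
    using G_fraction_dvd[OF \<open>p > 0\<close> m] assms(3,7) greedy_underapprox_1 by simp
  have "m > 0"
    using m assms(1,2) by (metis add_pos_pos zero_less_mult_pos zero_less_one)
  have mr: "real_of_int p * real_of_int m = real_of_int q + 1"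
    using arg_cong[OF m, of real_of_int] by simp
  define P where "P k = (\<Prod>i = 1..k. a i)" for k
  have P_Suc: "P (Suc k) = P k * a (Suc k)" for k
    by (simp add: P_def)
  \<comment> \<open>Kept apart from the induction because it serves twice: in the inductive step and
    for the final recurrence.\<close>
  have next_term: "a (Suc k) = q * P k + 1"
    if "\<theta> = (\<Sum>i = 1..k. 1 / real_of_int (a i)) + 1 / real_of_int (q * P k)" for k
  proof -
    have "\<theta> - (\<Sum>i = 1..k. 1 / real_of_int (a i)) = 1 / real_of_int (q * P k)"
      using that by simp
    then show ?thesis
      using greedy_underapprox_step[of \<theta> k] assms(7) G_inverse_of_int[of "q * P k"] by simp
  qed
  \<comment> \<open>The induction starts at 1, since the initial remainder p/q need not be a unit
    fraction. Positivity of \<open>P k\<close> is carried along to keep the denominators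
    nonzero.\<close>
  have inv: "P k > 0 \<and> \<theta> = (\<Sum>i = 1..k. 1 / real_of_int (a i)) + 1 / real_of_int (q * P k)"
    if "k \<ge> 1" for k
    using that
  proof (induction k rule: dec_induct)
    case base
    \<comment> \<open>The right side is (q + 1)/(q * m), and q + 1 = p * m.\<close>
    have "real_of_int p / real_of_int q = 1 / real_of_int m + 1 / (real_of_int q * real_of_int m)"
      using mr \<open>m > 0\<close> assms(2) by (simp add: field_simps)
    then show ?case using a1 \<open>m > 0\<close> assms(3) by (simp add: P_def)
  next
    case (step k)
    define N where "N = q * P k"
    have "N > 0" using step.IH assms(2) by (simp add: N_def)
    have aN: "a (Suc k) = N + 1"
      using next_term step.IH by (simp add: N_def)
    have qP: "q * P (Suc k) = N * (N + 1)"
      by (simp add: P_Suc aN N_def)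
    have "1 / real_of_int N = 1 / real_of_int (N + 1) + 1 / real_of_int (N * (N + 1))"
      using \<open>N > 0\<close> by (simp add: divide_simps)
    then have "\<theta> = (\<Sum>i = 1..Suc k. 1 / real_of_int (a i)) + 1 / real_of_int (q * P (Suc k))"
      using step.IH unfolding qP by (simp add: aN flip: N_def)
    moreover have "P (Suc k) > 0"
      using step.IH \<open>N > 0\<close> by (simp add: P_Suc aN)
    ultimately show ?case by blast
  qed
  have "real_of_int (a 1) = (real_of_int q + 1) / real_of_int p"
    using mr assms(1) unfolding a1 by (simp add: field_simps)
  moreover have "a (k + 1) = q * (\<Prod>i = 1..k. a i) + 1 \<and>
       real_of_int p / real_of_int q =
         (\<Sum>i = 1..k. 1 / real_of_int (a i)) + 1 / (real_of_int q * (\<Prod>i = 1..k. real_of_int (a i)))"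
    if "k \<ge> 1" for k
    using inv[OF that] next_term[of k] assms(3) by (simp add: P_def)
  ultimately show ?thesis by blast
qed

end
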